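(* Let $q\ge 3$ be a prime power and let $\boldsymbol\alpha=(\alpha_1,\ldots,\alpha_q)\in\mathbb{F}_q^q$ be an ordering of all elements of $\mathbb{F}_q$. Then the code $\mathrm{RS}_{q,2}(\boldsymbol\alpha)$ cannot correct a single insdel error if and only if $\boldsymbol\alpha$ is equivalent to one of the following vectors: (1) $(0,1,\theta,\ldots,\theta^{q-2})$ for some primitive element $\theta$ of $\mathbb{F}_q$; (2) $(\theta^{q-2},\ldots,\theta,1,0)$ for some primitive element $\theta$ of $\mathbb{F}_q$; (3) $(0,1,2,\ldots,q-1)$, if $q$ is prime.
   Context: For distinct elements $\alpha_1,\ldots,\alpha_n\in\mathbb{F}_q$ and $k<n$, the Reed--Solomon code with evaluation vector $\boldsymbol\alpha=(\alpha_1,\ldots,\alpha_n)$ is $\mathrm{RS}_{n,k}(\boldsymbol\alpha)=\{(f(\alpha_1),\ldots,f(\alpha_n)) : f\in\mathbb{F}_q[x],\ \deg f<k\}\subseteq\mathbb{F}_q^n$. Two evaluation vectors $\boldsymbol\alpha,\widetilde{\boldsymbol\alpha}\in\mathbb{F}_q^q$ are equivalent if $(\lambda\alpha_1+\mu,\ldots,\lambda\alpha_q+\mu)=\widetilde{\boldsymbol\alpha}$ for some $\lambda\in\mathbb{F}_q^*$ and $\mu\in\mathbb{F}_q$. An insdel error is an insertion of a symbol or a deletion of a symbol. A code $\mathcal{C}\subseteq\mathbb{F}_q^n$ can correct a single insdel error if no word can be obtained from two distinct codewords, each by at most one insertion or deletion. Equivalently, $\mathrm{LCS}(\mathbf{c},\mathbf{c}')\le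 n-2$ for all distinct $\mathbf{c},\mathbf{c}'\in\mathcal{C}$, where $\mathrm{LCS}$ denotes the length of a longest common (not necessarily contiguous) subsequence. *)

theory Defs
  imports "HOL-Computational_Algebra.Computational_Algebra" "HOL-Library.Cardinality"
begin

(* Words and vectors over an alphabet 'a are lists. *)

(* The disjunct f = 0 matters only for k = 0: the zero polynomial has degree minus infinity
   by convention, whereas degree 0 = 0 in the library. *)
definition reed_solomon :: "nat \<Rightarrow> 'a::field list \<Rightarrow> 'a list set" where
  "reed_solomon k \<alpha> = {map (poly f) \<alpha> | f. f = 0 \<or> degree f < k}"

definition equivalent_vectors :: "'a::field list \<Rightarrow> 'a list \<Rightarrow> bool" where
  "equivalent_vectors \<alpha> \<beta> \<longleftrightarrow> (\<exists>l m. l \<noteq> 0 \<and> map (\<lambda>x. l * x + m) \<alpha> = \<beta>)"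

definition insertion :: "'a list \<Rightarrow> 'a list \<Rightarrow> bool" where
  "insertion u w \<longleftrightarrow> (\<exists>xs x ys. u = xs @ ys \<and> w = xs @ [x] @ ys)"

definition deletion :: "'a list \<Rightarrow> 'a list \<Rightarrow> bool" where
  "deletion u w \<longleftrightarrow> (\<exists>xs x ys. u = xs @ [x] @ ys \<and> w = xs @ ys)"

definition at_most_one_insdel :: "'a list \<Rightarrow> 'a list \<Rightarrow> bool" where
  "at_most_one_insdel u w \<longleftrightarrow> w = u \<or> insertion u w \<or> deletion u w"

definition corrects_single_insdel :: "'a list set \<Rightarrow> bool" where
  "corrects_single_insdel C \<longleftrightarrow>
     \<not> (\<exists>c\<in>C. \<exists>c'\<in>C. c \<noteq> c' \<and> (\<exists>w. at_most_one_insdel c w \<and> at_most_one_insdel c' w))"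

(* A generator of the multiplicative group; for finite fields, natural exponents suffice. *)
definition primitive_element :: "'a::{field,finite} \<Rightarrow> bool" where
  "primitive_element \<theta> \<longleftrightarrow> range (\<lambda>i::nat. \<theta> ^ i) = UNIV - {0}"

end

theory Submission
  imports Defs
begin

text \<open>
  Two words of equal length within one insdel error of a common word have, up to order, the
  shapes \<open>A x Z B\<close> and \<open>A Z y B\<close>. If they are the images of \<open>\<alpha>\<close> under distinct affine maps
  \<open>f\<close> and \<open>g\<close>, then \<open>f\<close> and \<open>g\<close> agree on the positions of \<open>A\<close> and \<open>B\<close>, so \<open>A B\<close> has at most
  one letter, while on \<open>Z\<close> the affine map \<open>h = f\<^sup>-\<^sup>1 \<circ> g\<close> sends each entry of \<open>\<alpha>\<close> to the next.
  If \<open>A B\<close> is empty, a fixed point of \<open>h\<close> would contradict distinctness, so \<open>h\<close> is a translation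
  and \<open>\<alpha>\<close> is an arithmetic progression. If \<open>A B\<close> is one letter, the corresponding entry of \<open>\<alpha>\<close>
  is a fixed point of \<open>h\<close> and the others form a geometric progression around it; its ratio is
  primitive because it reaches every nonzero element. For \<open>q = 3\<close> one of \<open>f\<close>, \<open>g\<close> may be
  constant, but there all orderings are equivalent. Conversely, a progression is shifted by
  one place by its translation or dilation.
\<close>

section \<open>Affine recurrences\<close>

text \<open>Measured from the fixed point \<open>p\<close>, the affine map is multiplication by
  \<open>l\<close>.\<close>

lemma iterate_affine_around_fixed_point:
  fixes l :: "'a::field"
  assumes "\<And>t. t < n \<Longrightarrow> s (Suc t) = l * s t + m" and "l * p + m = p" and "t \<le> n"
  shows "s t = p + l ^ t * (s 0 - p)"
  using assms(3)
proof (induction t)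
  case (Suc t)
  then have "s (Suc t) = l * (p + l ^ t * (s 0 - p)) + m"
    using assms(1)[of t] by simp
  also have "\<dots> = (l * p + m) + l ^ Suc t * (s 0 - p)"
    by (simp add: algebra_simps)
  finally show ?case
    using assms(2) by simp
qed simp

section \<open>Words within one insdel error of a common word\<close>

lemma common_insdel_shape:
  assumes "at_most_one_insdel u w" "at_most_one_insdel v w" "length u = length v" "u \<noteq> v"
  obtains A x Z y B where
    "u = A @ x # Z @ B \<and> v = A @ Z @ y # B \<or> v = A @ x # Z @ B \<and> u = A @ Z @ y # B"
proof -
  have len: "length w = Suc (length a)" if "insertion a w" for a
    using that by (auto simp: insertion_def)
  have len': "Suc (length w) = length a" if "deletion a w" for a
    using that by (auto simp: deletion_def)
  \<comment> \<open>Equal lengths force the same kind of error on both sides; no error at all on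
    both sides would give \<open>u = v\<close>.\<close>
  consider "insertion u w" "insertion v w" | "deletion u w" "deletion v w"
    using assms len len' unfolding at_most_one_insdel_def by force
  then show thesis
  proof cases
    case 1
    then obtain P p Q P' p' Q' where
      u: "u = P @ Q" "w = P @ [p] @ Q" and v: "v = P' @ Q'" "w = P' @ [p'] @ Q'"
      unfolding insertion_def by blast
    from u(2) v(2) have "P @ p # Q = P' @ p' # Q'" by simp
    \<comment> \<open>The two inserted letters sit at the same place in \<open>w\<close>, or one
      lies before the other with \<open>Z\<close> in between.\<close>
    then consider "P = P'" "Q = Q'"
      | Z where "P' = P @ p # Z" "Q = Z @ p' # Q'"
      | Z where "P = P' @ p' # Z" "Q' = Z @ p # Q"
      by (auto simp: append_eq_append_conv2 append_eq_Cons_conv Cons_eq_append_conv)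
    then show thesis
    proof cases
      case 1 with u v assms(4) show thesis by simp
    next
      case (2 Z)
      then show thesis using that[of P p Z Q' p'] u v by simp
    next
      case (3 Z)
      then show thesis using that[of P' p' Z Q p] u v by simp
    qed
  next
    case 2
    then obtain P p Q P' p' Q' where
      u: "w = P @ Q" "u = P @ [p] @ Q" and v: "w = P' @ Q'" "v = P' @ [p'] @ Q'"
      unfolding deletion_def by blast
    from u(1) v(1) have "P @ Q = P' @ Q'" by simp
    then consider Z where "P' = P @ Z" "Q = Z @ Q'" | Z where "P = P' @ Z" "Q' = Z @ Q"
      by (auto simp: append_eq_append_conv2)
    then show thesis
    proof cases
      case (1 Z)
      then show thesis using that[of P p Z Q' p'] u v by simp
    next
      case (2 Z)
      then show thesis using that[of P' p' Z Q p] u v by simp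
    qed
  qed
qed

text \<open>Codewords of equal length that can be confused have the shape above, up to swapping
  them. Conversely, deleting \<open>x\<close> from one and \<open>y\<close> from the other leaves
  \<open>A @ Z @ B\<close>.\<close>

lemma not_corrects_single_insdel_iff:
  assumes "\<forall>c\<in>C. length c = n"
  shows "\<not> corrects_single_insdel C \<longleftrightarrow>
    (\<exists>A x Z y B. A @ x # Z @ B \<in> C \<and> A @ Z @ y # B \<in> C \<and> A @ x # Z @ B \<noteq> A @ Z @ y # B)"
    (is "?L \<longleftrightarrow> ?R")
proof
  assume ?L
  then obtain c c' w where c: "c \<in> C" "c' \<in> C" "c \<noteq> c'"
    "at_most_one_insdel c w" "at_most_one_insdel c' w"
    unfolding corrects_single_insdel_def by blast
  have "length c = length c'"
    using assms c by simp
  from common_insdel_shape[OF c(4,5) this c(3)] obtain A x Z y B where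
    "c = A @ x # Z @ B \<and> c' = A @ Z @ y # B \<or> c' = A @ x # Z @ B \<and> c = A @ Z @ y # B" .
  then show ?R
    using c(1-3) by metis
next
  assume ?R
  then obtain A x Z y B where
    *: "A @ x # Z @ B \<in> C" "A @ Z @ y # B \<in> C" "A @ x # Z @ B \<noteq> A @ Z @ y # B"
    by blast
  have "deletion (A @ x # Z @ B) (A @ Z @ B)"
    unfolding deletion_def by (intro exI[of _ A] exI[of _ x] exI[of _ "Z @ B"]) simp
  moreover have "deletion (A @ Z @ y # B) (A @ Z @ B)"
    unfolding deletion_def by (intro exI[of _ "A @ Z"] exI[of _ y] exI[of _ B]) simp
  ultimately show ?L
    using * unfolding corrects_single_insdel_def at_most_one_insdel_def by blast
qed

section \<open>Affine codewords and equivalence of evaluation vectors\<close>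

lemma reed_solomon_2:
  "reed_solomon 2 \<alpha> = {map (\<lambda>x. a * x + b) \<alpha> | a b. True}"
proof (intro equalityI subsetI)
  fix c assume "c \<in> reed_solomon 2 \<alpha>"
  then obtain f where f: "c = map (poly f) \<alpha>" "f = 0 \<or> degree f < 2"
    unfolding reed_solomon_def by blast
  have "f = [:coeff f 0, coeff f 1:]"
    using f(2) by (auto intro!: poly_eqI simp: coeff_pCons coeff_eq_0 split: nat.split)
  then have "poly f = (\<lambda>x. coeff f 1 * x + coeff f 0)"
    by (metis (no_types, opaque_lifting) add.commute add_0 mult.commute mult_zero_right
        poly_0 poly_pCons)
  then show "c \<in> {map (\<lambda>x. a * x + b) \<alpha> | a b. True}"
    using f(1) by auto
next
  fix c assume "c \<in> {map (\<lambda>x. a * x + b) \<alpha> | a b. True}"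
  then obtain a b where "c = map (\<lambda>x. a * x + b) \<alpha>" by blast
  then have "c = map (poly [:b, a:]) \<alpha>"
    by (simp add: algebra_simps)
  moreover have "degree [:b, a:] < 2" by simp
  ultimately show "c \<in> reed_solomon 2 \<alpha>"
    unfolding reed_solomon_def by blast
qed

lemma affine_eq_if_agree_twice:
  fixes a b c d x y :: "'a::field"
  assumes "a * x + b = c * x + d" "a * y + b = c * y + d" "x \<noteq> y"
  shows "a = c \<and> b = d"
proof -
  have "(a - c) * (x - y) = 0"
    using assms(1,2) by (simp add: algebra_simps) algebra
  then show ?thesis using assms by auto
qed

lemma equivalent_vectorsI:
  assumes "l \<noteq> 0" "length \<alpha> = length \<beta>"
    and "\<And>i. i < length \<alpha> \<Longrightarrow> l * \<alpha> ! i + m = \<beta> ! i"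
  shows "equivalent_vectors \<alpha> \<beta>"
proof -
  have "map (\<lambda>x. l * x + m) \<alpha> = \<beta>"
    using assms(2,3) by (intro nth_equalityI) simp_all
  then show ?thesis
    unfolding equivalent_vectors_def using assms(1) by blast
qed

text \<open>Affine maps act letter by letter and so commute with reversal. This reduces the second
  family of the theorem to the first.\<close>

lemma equivalent_vectors_rev:
  "equivalent_vectors (rev \<alpha>) \<beta> \<longleftrightarrow> equivalent_vectors \<alpha> (rev \<beta>)"
  unfolding equivalent_vectors_def rev_map[symmetric] rev_swap ..

section \<open>Progressions forced by a shifting affine map\<close>

text \<open>The shifting map has no fixed point, so it is a translation by some nonzero
  \<open>m\<close>, and dividing by \<open>m\<close> gives the normal form. Its orbit is the whole
  field, so the characteristic is \<open>q\<close>, which makes \<open>q\<close> prime.\<close>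

lemma arithmetic_progression:
  fixes \<alpha> :: "'a::{field,finite} list"
  assumes dist: "distinct \<alpha>" and UN: "set \<alpha> = UNIV" and len: "length \<alpha> = q" and "q \<ge> 2"
    and l: "l \<noteq> 0" and step: "\<And>t. Suc t < q \<Longrightarrow> \<alpha> ! Suc t = l * \<alpha> ! t + m"
  shows "prime q \<and> equivalent_vectors \<alpha> (map of_nat [0..<q])"
proof -
  have no_fix: "l * p + m \<noteq> p" for p
  proof
    assume p: "l * p + m = p"
    obtain s where s: "s < q" "\<alpha> ! s = p"
      using UN len by (metis UNIV_I in_set_conv_nth)
    \<comment> \<open>A fixed entry with a successor would be repeated there. If it is last, its
      predecessor has the same image, against injectivity.\<close>
    show False
    proof (cases "Suc s < q")
      case True
      then have "\<alpha> ! Suc s = \<alpha> ! s" using step s p by simp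
      then show False using nth_eq_iff_index_eq[OF dist, of "Suc s" s] True s len by simp
    next
      case False
      then obtain r where r: "s = Suc r" using s \<open>q \<ge> 2\<close> by (cases s) auto
      have "l * \<alpha> ! r + m = l * \<alpha> ! s + m" using step[of r] s p r by simp
      then have "\<alpha> ! r = \<alpha> ! s" using l by simp
      then show False using dist s r len by (simp add: nth_eq_iff_index_eq)
    qed
  qed
  have "l = 1"
  proof (rule ccontr)
    assume "l \<noteq> 1"
    then have "l * (m / (1 - l)) + m = m / (1 - l)" by (simp add: field_simps)
    with no_fix show False by blast
  qed
  have m: "m \<noteq> 0" using no_fix[of 0] by simp
  have prog: "\<alpha> ! t = \<alpha> ! 0 + of_nat t * m" if "t < q" for t
    using that by (induction t) (auto simp: step \<open>l = 1\<close> algebra_simps)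
  have "equivalent_vectors \<alpha> (map of_nat [0..<q])"
  proof (rule equivalent_vectorsI)
    show "inverse m \<noteq> 0" using m by simp
    show "inverse m * \<alpha> ! i + - (\<alpha> ! 0 / m) = map of_nat [0..<q] ! i" if "i < length \<alpha>" for i
      using that len m prog[of i] by (simp add: field_simps)
  qed (use len in simp)
  moreover have "CHAR('a) = q"
  proof (rule antisym)
    \<comment> \<open>This entry is one translation short of the start, so \<open>Suc s\<close>
      translations give the identity.\<close>
    obtain s where s: "s < q" "\<alpha> ! s = \<alpha> ! 0 - m"
      using UN len by (metis UNIV_I in_set_conv_nth)
    then have "of_nat (Suc s) * m = 0"
      using prog[of s] by (simp add: algebra_simps)
    then have "CHAR('a) dvd Suc s"
      using m by (simp add: of_nat_eq_0_iff_char_dvd del: of_nat_Suc)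
    then have "CHAR('a) \<le> Suc s"
      by (rule dvd_imp_le) simp
    with s show "CHAR('a) \<le> q" by simp
    show "q \<le> CHAR('a)"
    proof (rule ccontr)
      assume "\<not> q \<le> CHAR('a)"
      then have c: "CHAR('a) < q" by simp
      then have "\<alpha> ! CHAR('a) = \<alpha> ! 0" using prog[OF c] by simp
      then have "CHAR('a) = 0" using c dist len by (simp add: nth_eq_iff_index_eq)
      then show False using finite_imp_CHAR_pos[where 'a='a] by simp
    qed
  qed
  moreover have "prime (CHAR('a))"
    by (intro prime_CHAR_semidom finite_imp_CHAR_pos) simp
  ultimately show ?thesis by simp
qed

text \<open>The offsets from the fixed entry \<open>\<alpha> ! 0\<close> are \<open>d\<close>,
  \<open>l * d\<close>, \<open>l ^ 2 * d\<close> and so on. They exhaust the nonzero elements, so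
  the powers of \<open>l\<close> do too; dividing by \<open>d\<close> gives the normal form.\<close>

lemma geometric_progression:
  fixes \<alpha> :: "'a::{field,finite} list"
  assumes dist: "distinct \<alpha>" and UN: "set \<alpha> = UNIV" and len: "length \<alpha> = q" and q: "q \<ge> 2"
    and l: "l \<noteq> 0" and fix0: "l * \<alpha> ! 0 + m = \<alpha> ! 0"
    and step: "\<And>t. 0 < t \<Longrightarrow> Suc t < q \<Longrightarrow> \<alpha> ! Suc t = l * \<alpha> ! t + m"
  shows "primitive_element l \<and> equivalent_vectors \<alpha> (0 # map (\<lambda>i. l ^ i) [0..<q - 1])"
proof -
  define d where "d = \<alpha> ! 1 - \<alpha> ! 0"
  have d: "d \<noteq> 0"
    unfolding d_def using dist q len by (simp add: nth_eq_iff_index_eq)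
  have prog: "\<alpha> ! Suc t = \<alpha> ! 0 + l ^ t * d" if "Suc t < q" for t
    \<comment> \<open>The iteration starts at index 1, which leaves \<open>q - 2\<close> steps up to
      the last index.\<close>
    using iterate_affine_around_fixed_point[of "q - 2" "\<lambda>t. \<alpha> ! Suc t" l m "\<alpha> ! 0" t]
      step fix0 that q by (simp add: d_def)
  have "x \<in> range (\<lambda>i. l ^ i)" if "x \<noteq> 0" for x
  proof -
    obtain s where s: "s < q" "\<alpha> ! s = \<alpha> ! 0 + x * d"
      using UN len by (metis UNIV_I in_set_conv_nth)
    with that d obtain t where "s = Suc t" by (cases s) auto
    then have "x = l ^ t" using s prog[of t] d by simp
    then show ?thesis by simp
  qed
  then have "primitive_element l"
    using l unfolding primitive_element_def by auto
  moreover have "equivalent_vectors \<alpha> (0 # map (\<lambda>i. l ^ i) [0..<q - 1])"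
  proof (rule equivalent_vectorsI)
    show "inverse d \<noteq> 0" using d by simp
    show "inverse d * \<alpha> ! i + - (\<alpha> ! 0 / d) = (0 # map (\<lambda>i. l ^ i) [0..<q - 1]) ! i"
      if "i < length \<alpha>" for i
      using that len d prog[of "i - 1"] by (cases i) (simp_all add: field_simps)
  qed (use len q in simp)
  ultimately show ?thesis by simp
qed

text \<open>Distinct affine maps agree at most once, which leaves at most one position outside the
  shifted block. The bound \<open>q \<ge> 4\<close> then guarantees two consecutive shifts, enough
  to exclude constant maps.\<close>

lemma progression_if_shifted_affine_images:
  fixes \<alpha> :: "'a::{field,finite} list"
  assumes dist: "distinct \<alpha>" and UN: "set \<alpha> = UNIV" and len: "length \<alpha> = q" and q: "q \<ge> 4"
    and f: "map (\<lambda>x. a * x + b) \<alpha> = A @ x # Z @ B"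
    and g: "map (\<lambda>x. c * x + d) \<alpha> = A @ Z @ y # B"
    and ne: "A @ x # Z @ B \<noteq> A @ Z @ y # B"
  shows "(\<exists>\<theta>. primitive_element \<theta> \<and>
        equivalent_vectors \<alpha> (0 # map (\<lambda>i. \<theta> ^ i) [0..<q - 1])) \<or>
    (\<exists>\<theta>. primitive_element \<theta> \<and>
        equivalent_vectors \<alpha> (rev (map (\<lambda>i. \<theta> ^ i) [0..<q - 1]) @ [0])) \<or>
    (prime q \<and> equivalent_vectors \<alpha> (map of_nat [0..<q]))"
proof -
  \<comment> \<open>\<open>i\<close> is the position of \<open>x\<close> in the first word and
    \<open>j\<close> that of \<open>y\<close> in the second.\<close>
  define i where "i = length A"
  define j where "j = i + length Z"
  have q_eq: "q = Suc (j + length B)"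
    using arg_cong[OF f, of length] len unfolding i_def j_def by simp
  have fn: "a * \<alpha> ! t + b = (A @ x # Z @ B) ! t" and gn: "c * \<alpha> ! t + d = (A @ Z @ y # B) ! t"
    if "t < q" for t
    using that len arg_cong[OF f, of "\<lambda>xs. xs ! t"] arg_cong[OF g, of "\<lambda>xs. xs ! t"] by simp_all
  have agree: "a * \<alpha> ! t + b = c * \<alpha> ! t + d" if "t < q" "t < i \<or> j < t" for t
    using that(2)
  proof
    assume "t < i"
    then show ?thesis using that(1) fn[of t] gn[of t] by (simp add: i_def nth_append)
  next
    assume "j < t"
    then obtain k where "t = length A + Suc (length Z + k)"
      by (auto simp: i_def j_def dest: less_imp_Suc_add)
    then show ?thesis using that(1) fn[of t] gn[of t] by (simp add: nth_append)
  qed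
  have shift: "a * \<alpha> ! Suc t + b = c * \<alpha> ! t + d" if "i \<le> t" "t < j" for t
  proof -
    obtain k where "t = i + k"
      using le_Suc_ex[OF \<open>i \<le> t\<close>] by blast
    then show ?thesis
      using that fn[of "Suc t"] gn[of t] q_eq by (simp add: i_def j_def nth_append)
  qed
  have ne': "\<not> (a = c \<and> b = d)"
    using ne f g by auto
  have idx: "\<alpha> ! s = \<alpha> ! t \<longleftrightarrow> s = t" if "s < q" "t < q" for s t
    using that dist len by (simp add: nth_eq_iff_index_eq)
  have uniq: "s = t" if "s < q" "t < q" "s < i \<or> j < s" "t < i \<or> j < t" for s t
    using affine_eq_if_agree_twice[OF agree[of s] agree[of t]] that ne' idx by blast
  have "j < q" "i \<le> j" using q_eq by (auto simp: j_def)
  \<comment> \<open>Two positions before \<open>i\<close>, two after \<open>j\<close>, or one on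
    each side would be two points of agreement.\<close>
  have i1: "i \<le> 1" using uniq[of 0 1] \<open>j < q\<close> \<open>i \<le> j\<close> q by linarith
  have j1: "j \<ge> q - 2" using uniq[of "q - 1" "q - 2"] q by linarith
  have ij: "i = 0 \<or> j = q - 1"
    using uniq[of 0 "q - 1"] q \<open>j < q\<close> by linarith
  have ij2: "Suc i < j" using i1 j1 ij q by linarith
  have sh: "a * \<alpha> ! Suc i + b = c * \<alpha> ! i + d" "a * \<alpha> ! Suc (Suc i) + b = c * \<alpha> ! Suc i + d"
    using shift[of i] shift[of "Suc i"] ij2 by simp_all
  have dst: "\<alpha> ! i \<noteq> \<alpha> ! Suc i" "\<alpha> ! Suc i \<noteq> \<alpha> ! Suc (Suc i)"
    using idx ij2 \<open>j < q\<close> by simp_all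
  \<comment> \<open>If one map is constant, the two shifts make the other take equal values at
    distinct points. Both are then constant with the same value, against \<open>ne'\<close>.\<close>
  have "a = 0 \<longleftrightarrow> c = 0"
    using sh dst by (metis add_right_cancel mult_cancel_left)
  moreover have "a \<noteq> 0 \<or> c \<noteq> 0"
    using sh ne' by auto
  ultimately have ac: "a \<noteq> 0" "c \<noteq> 0" by auto
  \<comment> \<open>These are the coefficients of \<open>h\<close>, found by solving
    \<open>a * x' + b = c * x + d\<close> for \<open>x'\<close>.\<close>
  define l m where "l = c / a" and "m = (d - b) / a"
  have step: "\<alpha> ! Suc t = l * \<alpha> ! t + m" if "i \<le> t" "t < j" for t
    using shift[OF that] ac unfolding l_def m_def by (simp add: field_simps) algebra
  have l: "l \<noteq> 0" using ac by (simp add: l_def)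
  have fixp: "l * \<alpha> ! t + m = \<alpha> ! t" if "t < q" "t < i \<or> j < t" for t
    using agree[OF that] ac unfolding l_def m_def by (simp add: field_simps) algebra
  consider "i = 0" "j = q - 1" | "i = 1" "j = q - 1" | "i = 0" "j = q - 2"
    using i1 j1 ij \<open>j < q\<close> by linarith
  then show ?thesis
  proof cases
    case 1
    then show ?thesis
      using arithmetic_progression[OF dist UN len _ l] step q by simp
  next
    case 2
    then show ?thesis
      using geometric_progression[OF dist UN len _ l, of m] step fixp[of 0] q by auto
  next
    case 3
    \<comment> \<open>Here the fixed entry is last. Reversal puts it first and replaces
      \<open>h\<close> by its inverse, whose ratio is \<open>inverse l\<close>.\<close>
    have rev_step: "inverse l * rev \<alpha> ! t + - (m / l) = rev \<alpha> ! Suc t"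
      if "0 < t" "Suc t < q" for t
    proof -
      have "rev \<alpha> ! t = \<alpha> ! Suc (q - Suc (Suc t))" "rev \<alpha> ! Suc t = \<alpha> ! (q - Suc (Suc t))"
        using that len by (simp_all add: rev_nth Suc_diff_Suc)
      moreover have "\<alpha> ! Suc (q - Suc (Suc t)) = l * \<alpha> ! (q - Suc (Suc t)) + m"
        using that 3 by (intro step) auto
      ultimately show ?thesis using l by (simp add: field_simps)
    qed
    have "rev \<alpha> ! 0 = \<alpha> ! (q - 1)"
      using len q by (simp add: rev_nth)
    then have "inverse l * rev \<alpha> ! 0 + - (m / l) = rev \<alpha> ! 0"
      using fixp[of "q - 1"] 3 q l by (simp add: field_simps)
    with rev_step have "primitive_element (inverse l) \<and>
        equivalent_vectors (rev \<alpha>) (0 # map (\<lambda>i. inverse l ^ i) [0..<q - 1])"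
      using l dist UN len q by (intro geometric_progression[where m = "- (m / l)"]) auto
    then show ?thesis
      unfolding equivalent_vectors_rev by auto
  qed
qed

section \<open>The field with three elements\<close>

text \<open>An affine map sends the first two entries to 0 and 1, and the third to the only
  remaining element \<open>z\<close>, which must be 2.\<close>

lemma field_card_3_equivalent:
  fixes \<alpha> :: "'a::{field,finite} list"
  assumes "distinct \<alpha>" "set \<alpha> = UNIV" "length \<alpha> = 3"
  shows "equivalent_vectors \<alpha> (map of_nat [0..<3])"
proof -
  obtain a b c where \<alpha>: "\<alpha> = [a, b, c]"
    using assms(3) by (auto simp: numeral_3_eq_3 length_Suc_conv)
  define z where "z = (c - a) / (b - a)"
  have ne: "b \<noteq> a" "c \<noteq> a" "b \<noteq> c" using assms(1) \<alpha> by auto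
  then have z: "z \<noteq> 0" "z \<noteq> 1" unfolding z_def by auto
  have all: "w = 0 \<or> w = 1 \<or> w = z" for w
  proof -
    have "a + w * (b - a) \<in> {a, b, c}" using assms(2) \<alpha> by auto
    then obtain v where v: "a + w * (b - a) = v" "v \<in> {a, b, c}" by blast
    then have "w = (v - a) / (b - a)" using ne by (simp add: eq_divide_eq v(1)[symmetric])
    then show ?thesis using v(2) ne unfolding z_def by auto
  qed
  \<comment> \<open>\<open>z + 1\<close> differs from \<open>z\<close>, and from 1 because
    \<open>z\<close> is nonzero.\<close>
  have "z + 1 = 0"
    using all[of "z + 1"] z by auto
  then have "1 + 1 \<noteq> (0::'a)"
    using z by (metis add_right_cancel)
  moreover have "1 + 1 \<noteq> (1::'a)"
    by (metis add.right_neutral add_left_cancel zero_neq_one)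
  ultimately have "z = 1 + 1"
    using all[of "1 + 1"] by metis
  then have "z = 2" by simp
  have "inverse (b - a) * x + - (a / (b - a)) = (x - a) / (b - a)" for x
    by (simp add: divide_inverse algebra_simps)
  then have "map (\<lambda>x. inverse (b - a) * x + - (a / (b - a))) \<alpha> = [0, 1, z]"
    using ne by (simp add: z_def \<alpha>)
  moreover have "map of_nat [0..<3] = [0, 1, z]"
    using \<open>z = 2\<close> by (simp add: upt_rec)
  moreover have "inverse (b - a) \<noteq> 0" using ne by simp
  ultimately show ?thesis
    unfolding equivalent_vectors_def by metis
qed

section \<open>Progressions yield codewords that can be confused\<close>

text \<open>Both \<open>\<beta>\<close> and its affine image are affine images of
  \<open>\<alpha>\<close>, hence codewords. It thus suffices to shift the normal form
  itself.\<close>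

lemma not_corrects_if_equivalent:
  fixes \<alpha> \<beta> :: "'a::field list"
  assumes "equivalent_vectors \<alpha> \<beta>"
    and "\<beta> = A @ x # Z @ B" "map (\<lambda>x. u * x + v) \<beta> = A @ Z @ y # B" "map (\<lambda>x. u * x + v) \<beta> \<noteq> \<beta>"
  shows "\<not> corrects_single_insdel (reed_solomon 2 \<alpha>)"
proof -
  obtain l m where lm: "map (\<lambda>x. l * x + m) \<alpha> = \<beta>"
    using assms(1) unfolding equivalent_vectors_def by blast
  have "\<beta> \<in> reed_solomon 2 \<alpha>"
    unfolding reed_solomon_2 using lm by blast
  moreover have "map (\<lambda>x. u * x + v) \<beta> = map (\<lambda>x. (u * l) * x + (u * m + v)) \<alpha>"
    by (simp add: lm[symmetric] algebra_simps)
  then have "map (\<lambda>x. u * x + v) \<beta> \<in> reed_solomon 2 \<alpha>"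
    unfolding reed_solomon_2 by blast
  moreover have "\<forall>c \<in> reed_solomon 2 \<alpha>. length c = length \<alpha>"
    unfolding reed_solomon_2 by auto
  ultimately show ?thesis
    using not_corrects_single_insdel_iff[of "reed_solomon 2 \<alpha>" "length \<alpha>"] assms(2-4) by metis
qed

lemma reed_solomon_rev: "reed_solomon k (rev \<alpha>) = rev ` reed_solomon k \<alpha>"
proof -
  have "rev ` reed_solomon k \<alpha> = {rev (map (poly f) \<alpha>) | f. f = 0 \<or> degree f < k}"
    unfolding reed_solomon_def by blast
  then show ?thesis
    by (simp add: reed_solomon_def rev_map)
qed

text \<open>Reversal interchanges the two shapes, with \<open>A\<close> and \<open>B\<close> as well
  as \<open>x\<close> and \<open>y\<close> trading roles.\<close>

lemma not_corrects_reed_solomon_rev: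
  assumes "\<not> corrects_single_insdel (reed_solomon k \<alpha>)"
  shows "\<not> corrects_single_insdel (reed_solomon k (rev \<alpha>))"
proof -
  have len: "\<forall>c \<in> reed_solomon k \<alpha>. length c = length \<alpha>"
    unfolding reed_solomon_def by auto
  obtain A x Z y B where "A @ x # Z @ B \<in> reed_solomon k \<alpha>" "A @ Z @ y # B \<in> reed_solomon k \<alpha>"
    "A @ x # Z @ B \<noteq> A @ Z @ y # B"
    using assms unfolding not_corrects_single_insdel_iff[OF len] by blast
  then have "rev (A @ Z @ y # B) \<in> reed_solomon k (rev \<alpha>)"
    "rev (A @ x # Z @ B) \<in> reed_solomon k (rev \<alpha>)" "rev (A @ Z @ y # B) \<noteq> rev (A @ x # Z @ B)"
    unfolding reed_solomon_rev by (blast, blast, metis rev_rev_ident)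
  then have "rev B @ y # rev Z @ rev A \<in> reed_solomon k (rev \<alpha>)"
    "rev B @ rev Z @ x # rev A \<in> reed_solomon k (rev \<alpha>)"
    "rev B @ y # rev Z @ rev A \<noteq> rev B @ rev Z @ x # rev A"
    by simp_all
  moreover have "\<forall>c \<in> reed_solomon k (rev \<alpha>). length c = length \<alpha>"
    unfolding reed_solomon_def by auto
  ultimately show ?thesis
    using not_corrects_single_insdel_iff[of "reed_solomon k (rev \<alpha>)" "length \<alpha>"] by blast
qed

text \<open>Dilation by \<open>\<theta>\<close> fixes the leading 0 and shifts the powers by one
  place.\<close>

lemma not_corrects_if_geometric:
  fixes \<theta> :: "'a::{field,finite}"
  assumes "primitive_element \<theta>" "q \<ge> 3" "CARD('a) = q"
    and "equivalent_vectors \<alpha> (0 # map (\<lambda>i. \<theta> ^ i) [0..<q - 1])"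
  shows "\<not> corrects_single_insdel (reed_solomon 2 \<alpha>)"
proof (rule not_corrects_if_equivalent[OF assms(4), where u = \<theta> and v = 0 and A = "[0]" and x = 1
      and Z = "map (\<lambda>i. \<theta> ^ Suc i) [0..<q - 2]" and B = "[]" and y = "\<theta> ^ (q - 1)"])
  have q1: "q - 1 = Suc (q - 2)" using assms(2) by simp
  show "0 # map (\<lambda>i. \<theta> ^ i) [0..<q - 1] =
      [0] @ 1 # map (\<lambda>i. \<theta> ^ Suc i) [0..<q - 2] @ []"
    unfolding q1 by (simp add: upt_conv_Cons map_Suc_upt[symmetric] del: upt_Suc)
  show "map (\<lambda>x. \<theta> * x + 0) (0 # map (\<lambda>i. \<theta> ^ i) [0..<q - 1]) =
      [0] @ map (\<lambda>i. \<theta> ^ Suc i) [0..<q - 2] @ \<theta> ^ (q - 1) # []"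
    unfolding q1 by simp
  \<comment> \<open>The two words differ at the position of the power \<open>\<theta> ^ 0\<close>
    once \<open>\<theta>\<close> is not 1, which \<open>q \<ge> 3\<close> ensures.\<close>
  have "\<theta> \<noteq> 1"
  proof
    assume "\<theta> = 1"
    then have "UNIV - {0::'a} = {1}"
      using assms(1) unfolding primitive_element_def by auto
    then have "(UNIV :: 'a set) = {0, 1}" by blast
    then have "CARD('a) = 2" by (metis card_2_iff zero_neq_one)
    then show False using assms by simp
  qed
  then show "map (\<lambda>x. \<theta> * x + 0) (0 # map (\<lambda>i. \<theta> ^ i) [0..<q - 1]) \<noteq>
      0 # map (\<lambda>i. \<theta> ^ i) [0..<q - 1]"
    unfolding q1 by (simp add: upt_conv_Cons del: upt_Suc)
qed

text \<open>Translation by 1 drops the leading 0 and appends \<open>of_nat q\<close>; the first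
  letters 0 and 1 tell the words apart.\<close>

lemma not_corrects_if_arithmetic:
  assumes "q \<ge> 1" "equivalent_vectors \<alpha> (map of_nat [0..<q])"
  shows "\<not> corrects_single_insdel (reed_solomon 2 \<alpha>)"
proof (rule not_corrects_if_equivalent[OF assms(2), where u = 1 and v = 1 and A = "[]" and x = 0
      and Z = "map (\<lambda>i. of_nat (Suc i)) [0..<q - 1]" and B = "[]" and y = "of_nat q"])
  have q1: "q = Suc (q - 1)" using assms(1) by simp
  show "map of_nat [0..<q] = [] @ 0 # map (\<lambda>i. of_nat (Suc i)) [0..<q - 1] @ []"
    by (subst q1) (simp add: upt_conv_Cons map_Suc_upt[symmetric] del: upt_Suc)
  show "map (\<lambda>x. 1 * x + 1) (map of_nat [0..<q]) =
      [] @ map (\<lambda>i. of_nat (Suc i)) [0..<q - 1] @ of_nat q # []"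
    by (subst (1 3) q1) (simp add: add.commute)
  show "map (\<lambda>x. 1 * x + 1) (map of_nat [0..<q]) \<noteq> map of_nat [0..<q]"
    by (subst (1 2) q1) (simp add: upt_conv_Cons del: upt_Suc)
qed

section \<open>Characterization of the orderings that fail to correct an insdel error\<close>

theorem lemma4:
  fixes q :: nat and \<alpha> :: "'a::{field,finite} list"
  assumes "CARD('a) = q" and "q \<ge> 3"
    and "distinct \<alpha>" and "set \<alpha> = UNIV"
  shows "\<not> corrects_single_insdel (reed_solomon 2 \<alpha>) \<longleftrightarrow>
    (\<exists>\<theta>. primitive_element \<theta> \<and>
        equivalent_vectors \<alpha> (0 # map (\<lambda>i. \<theta> ^ i) [0..<q - 1])) \<or>
    (\<exists>\<theta>. primitive_element \<theta> \<and>
        equivalent_vectors \<alpha> (rev (map (\<lambda>i. \<theta> ^ i) [0..<q - 1]) @ [0])) \<or>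
    (prime q \<and> equivalent_vectors \<alpha> (map of_nat [0..<q]))"
    (is "?L \<longleftrightarrow> ?R")
proof
  have len: "length \<alpha> = q"
    using assms by (metis distinct_card)
  assume ?L
  show ?R
  \<comment> \<open>For \<open>q = 3\<close> the third alternative holds for every ordering.\<close>
  proof (cases "q = 3")
    case True
    then show ?thesis
      using field_card_3_equivalent[OF assms(3,4)] len by simp
  next
    case False
    have "\<forall>c \<in> reed_solomon 2 \<alpha>. length c = q"
      using len unfolding reed_solomon_def by auto
    from \<open>?L\<close>[unfolded not_corrects_single_insdel_iff[OF this]] obtain A x Z y B where
      "A @ x # Z @ B \<in> reed_solomon 2 \<alpha>" "A @ Z @ y # B \<in> reed_solomon 2 \<alpha>"
      and ne: "A @ x # Z @ B \<noteq> A @ Z @ y # B"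
      by blast
    then obtain a b c d where
      "A @ x # Z @ B = map (\<lambda>x. a * x + b) \<alpha>" "A @ Z @ y # B = map (\<lambda>x. c * x + d) \<alpha>"
      unfolding reed_solomon_2 by blast
    note f = this(1)[symmetric] and g = this(2)[symmetric]
    show ?thesis
      using progression_if_shifted_affine_images[OF assms(3,4) len _ f g ne] assms(2) False
      by simp
  qed
next
  assume ?R
  \<comment> \<open>The second family is restated as the first one for \<open>rev \<alpha>\<close>,
    so that reversing the code settles it.\<close>
  then consider
    \<theta> where "primitive_element \<theta>" "equivalent_vectors \<alpha> (0 # map (\<lambda>i. \<theta> ^ i) [0..<q - 1])"
  | \<theta> where "primitive_element \<theta>"
      "equivalent_vectors (rev \<alpha>) (0 # map (\<lambda>i. \<theta> ^ i) [0..<q - 1])"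
  | "equivalent_vectors \<alpha> (map of_nat [0..<q])"
    by (auto simp: equivalent_vectors_rev)
  then show ?L
  proof cases
    case 1
    then show ?thesis using not_corrects_if_geometric assms by blast
  next
    case 2
    then show ?thesis
      using not_corrects_if_geometric not_corrects_reed_solomon_rev[of 2 "rev \<alpha>"] assms
      by fastforce
  next
    case 3
    then show ?thesis using not_corrects_if_arithmetic[OF _ 3] assms by simp
  qed
qed

end
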